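(* Let $A,B>0$ be real numbers and $q$ a natural number, and let $f:\mathbb{Z}\to\mathbb{C}$ satisfy (i) $|f(m)|\le A$ for all $m\in\mathbb{Z}$; (ii) $f(m+q)=f(m)$ for all $m\in\mathbb{Z}$; (iii) $\sum_{m=1}^{q}\left|\sum_{k=1}^{K}f(m+k)\right|^2\le BqK$ for all natural numbers $K$. Let $n\ge 0$ be an integer and suppose $q\ge q_n^6$. Then for all integers $a$ and all positive integers $N$, \[ \left|\sum_{m=a+1}^{a+N}f(m)\right|\le\sqrt{B}\,\delta_n\sqrt{q}\log q+\left(\sqrt{B}\sqrt{q_n+\frac{1}{q_n^{2}}}+\sqrt{B}(\sqrt{2}-1)\frac{2p_n}{q_n-1}+\frac{1}{2}A\right)\sqrt{q}+\psi_n(q,B), \] where \[ \psi_n(q,B)=\sqrt{B}\left(q_n+\frac{1}{q_n^{2}}\right)\left(\delta_n\log q+(\sqrt{2}-1)\frac{2p_n}{q_n-1}\right). \]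
   Context: The integer sequence $(q_n)_{n\ge -2}$ is defined by $q_{-2}=q_{-1}=1$ and $q_n=2q_{n-1}+q_{n-2}$ for $n\ge 0$ (so $q_0=3,q_1=7,q_2=17,\dots$). The sequence $(p_n)_{n\ge-2}$ is defined by $p_{-2}=p_{-1}=0$ and $p_n=2p_{n-1}+p_{n-2}+\frac{q_{n-1}+q_{n-2}}{2}$ for $n\ge 0$. For $n\ge 0$, $\delta_n=\frac{p_n}{q_n\log q_n}$. Here $\log$ is the natural logarithm. *)

theory Defs
  imports Complex_Main
begin

text \<open>
  The sequences of the source are indexed from \<open>-2\<close>; \<open>q_shift k\<close> and \<open>p_shift k\<close> are their terms
  of index \<open>k - 2\<close>.
\<close>

fun q_shift :: "nat \<Rightarrow> int" where
  "q_shift 0 = 1"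
| "q_shift (Suc 0) = 1"
| "q_shift (Suc (Suc k)) = 2 * q_shift (Suc k) + q_shift k"

text \<open>\<open>p_shift\<close> is real-valued so that the division by 2 is exact.\<close>

fun p_shift :: "nat \<Rightarrow> real" where
  "p_shift 0 = 0"
| "p_shift (Suc 0) = 0"
| "p_shift (Suc (Suc k)) =
     2 * p_shift (Suc k) + p_shift k + real_of_int (q_shift (Suc k) + q_shift k) / 2"

definition q_seq :: "nat \<Rightarrow> int" where
  "q_seq n = q_shift (n + 2)"

definition p_seq :: "nat \<Rightarrow> real" where
  "p_seq n = p_shift (n + 2)"

definition delta :: "nat \<Rightarrow> real" where
  "delta n = p_seq n / (real_of_int (q_seq n) * ln (real_of_int (q_seq n)))"

definition psi :: "nat \<Rightarrow> nat \<Rightarrow> real \<Rightarrow> real" where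
  "psi n q B =
     sqrt B * (real_of_int (q_seq n) + 1 / (real_of_int (q_seq n))\<^sup>2) *
       (delta n * ln (real q)
        + (sqrt 2 - 1) * (2 * p_seq n / (real_of_int (q_seq n) - 1)))"

end

theory Submission
  imports "HOL-Analysis.Convex" Defs
begin

text \<open>
  Let \<open>G m = f (m + 1) + \<dots> + f (m + N)\<close>. A full period of \<open>f\<close> sums to zero, so one may assume
  \<open>2 N \<le> q\<close>. Compare the average of \<open>G\<close> over a window of length \<open>L\<close> with its average over the
  concentric window of length \<open>q\<^sub>n L\<close>. Moving the two outer pieces of the long window inwards by
  \<open>d = (q\<^sub>n\<^sub>-\<^sub>1 + q\<^sub>n\<^sub>-\<^sub>2) L / 2\<close>, their own length, turns it into two copies of the
  \<open>q\<^sub>n\<^sub>-\<^sub>1\<close>-window and one of the \<open>q\<^sub>n\<^sub>-\<^sub>2\<close>-window. Since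
  \<open>G (m + d) - G m\<close> is a difference of two sums of \<open>d\<close> terms, the error involves such sums over four
  disjoint windows of length \<open>d\<close>, and Cauchy-Schwarz together with the mean square hypothesis bounds it
  by \<open>2 d sqrt (B q)\<close>. By induction the two averages differ by at most
  \<open>2 (p\<^sub>n / q\<^sub>n) sqrt (B q)\<close>. Starting with \<open>L = \<lfloor>sqrt q\<rfloor>\<close>, where the average is within
  \<open>A sqrt q / 2\<close> of the value at the centre, and multiplying \<open>L\<close> by \<open>q\<^sub>n\<close> until
  \<open>N \<le> q\<^sub>n L\<close> takes at most \<open>ln q / (2 ln q\<^sub>n)\<close> steps; the last average is at most
  \<open>sqrt (B q N / L)\<close>, again by Cauchy-Schwarz.
\<close>

section \<open>Block sums and the integer sequences\<close>

definition block_sum :: "(int \<Rightarrow> complex) \<Rightarrow> int \<Rightarrow> nat \<Rightarrow> complex" where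
  "block_sum f m K = (\<Sum>k=1..int K. f (m + k))"

text \<open>\<open>q_shift k = 2 * half_q k + 1\<close>, so \<open>half_q k\<close> unit windows lie on each side of the central one.\<close>

fun half_q :: "nat \<Rightarrow> nat" where
  "half_q 0 = 0"
| "half_q (Suc 0) = 0"
| "half_q (Suc (Suc k)) = 2 * half_q (Suc k) + half_q k + 1"

lemma q_shift_eq_half_q: "q_shift k = 2 * int (half_q k) + 1"
  by (induction k rule: half_q.induct) auto

lemma half_q_mono: "half_q k \<le> half_q (Suc k)"
  by (cases k) auto

lemma p_shift_nonneg: "p_shift k \<ge> 0"
  by (induction k rule: p_shift.induct) (auto simp: q_shift_eq_half_q)

lemma p_seq_nonneg: "p_seq n \<ge> 0"
  unfolding p_seq_def by (rule p_shift_nonneg)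

lemma q_seq_ge_3: "q_seq n \<ge> 3"
  by (simp add: q_seq_def q_shift_eq_half_q)

lemma block_sum_0 [simp]: "block_sum f m 0 = 0"
  by (simp add: block_sum_def)

lemma block_sum_Suc: "block_sum f m (Suc K) = block_sum f m K + f (m + int K + 1)"
proof -
  have "{1..int (Suc K)} = insert (int K + 1) {1..int K}" by auto
  then show ?thesis by (simp add: block_sum_def ac_simps)
qed

lemma block_sum_add: "block_sum f m (K + J) = block_sum f m K + block_sum f (m + int K) J"
  by (induction J) (simp_all add: block_sum_Suc algebra_simps)

text \<open>Split the \<open>N + d\<close> terms after \<open>m\<close> once after \<open>d\<close>
  terms and once after \<open>N\<close> terms. A shift by \<open>d\<close> of a sum of length
  \<open>N\<close> thus becomes a difference of two sums of length \<open>d\<close>, to which the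
  mean square bound applies with \<open>K = d\<close>.\<close>

lemma block_sum_shift_diff:
  "block_sum f (m + int d) N - block_sum f m N = block_sum f (m + int N) d - block_sum f m d"
  using block_sum_add[of f m d N] block_sum_add[of f m N d] by (simp add: add.commute algebra_simps)

lemma block_sum_atLeastAtMost: "block_sum f a N = (\<Sum>m=a+1..a+int N. f m)"
  unfolding block_sum_def
  by (rule sum.reindex_bij_witness[where i="\<lambda>m. m - a" and j="\<lambda>k. a + k"]) auto

section \<open>Sums over half-open integer intervals\<close>

lemma sum_shift_int: "(\<Sum>m\<in>{a..<b}. g (m + d)) = (\<Sum>m\<in>{a+d..<b+d}. g m)" for a b d :: int
  by (rule sum.reindex_bij_witness[where i="\<lambda>m. m - d" and j="\<lambda>k. k + d"]) auto

lemma sum_concat_int: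
  fixes a b c :: int
  assumes "a \<le> b" "b \<le> c"
  shows "(\<Sum>m\<in>{a..<c}. g m) = (\<Sum>m\<in>{a..<b}. g m) + (\<Sum>m\<in>{b..<c}. g m)"
proof -
  have "{a..<c} = {a..<b} \<union> {b..<c}" using assms by auto
  then show ?thesis by (simp add: sum.union_disjoint)
qed

text \<open>Shifting the left outer piece \<open>[c-h2, c-h1)\<close> by \<open>d\<close> gives
  \<open>[c-h1, c+h+l)\<close>; the right outer piece \<open>[c+h1+l, c+h2+l)\<close> is
  \<open>[c-h, c+h1+l)\<close> shifted by \<open>d\<close>. The two replacement intervals overlap in
  the \<open>h\<close>-window and have the \<open>h1\<close>-window as union, so together with the
  middle piece they count the \<open>h1\<close>-window twice and the \<open>h\<close>-window
  once.\<close>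

lemma window_sum_recursion:
  fixes G :: "int \<Rightarrow> 'a::comm_ring_1" and c h h1 h2 d l :: int
  assumes "0 \<le> h" "0 \<le> l" "h \<le> h1" and h2: "h2 = h1 + d" and d: "d = h1 + h + l"
  shows "(\<Sum>m\<in>{c-h2..<c+h2+l}. G m)
    = 2 * (\<Sum>m\<in>{c-h1..<c+h1+l}. G m) + (\<Sum>m\<in>{c-h..<c+h+l}. G m)
      + ((\<Sum>m\<in>{c-h..<c-h+d}. G (m + d) - G m) - (\<Sum>m\<in>{c-h2..<c-h2+d}. G (m + d) - G m))"
proof -
  define g where "g = (\<lambda>a b. \<Sum>m\<in>{a..<b}. G m)"
  have cat: "g x z = g x y + g y z" if "x \<le> y" "y \<le> z" for x y z
    unfolding g_def by (rule sum_concat_int[OF that])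
  have c1: "g (c-h2) (c+h2+l) = g (c-h2) (c-h1) + g (c-h1) (c+h2+l)"
    by (rule cat) (use assms in linarith)+
  have c2: "g (c-h1) (c+h2+l) = g (c-h1) (c+h1+l) + g (c+h1+l) (c+h2+l)"
    by (rule cat) (use assms in linarith)+
  have c3: "g (c-h1) (c+h1+l) = g (c-h1) (c+h+l) + g (c+h+l) (c+h1+l)"
    by (rule cat) (use assms in linarith)+
  have c4: "g (c-h) (c+h1+l) = g (c-h) (c+h+l) + g (c+h+l) (c+h1+l)"
    by (rule cat) (use assms in linarith)+
  have s1: "(\<Sum>m\<in>{c-h..<c-h+d}. G (m + d) - G m) = g (c+h1+l) (c+h2+l) - g (c-h) (c+h1+l)"
  proof -
    have e: "c-h+d = c+h1+l" "c+h1+l+d = c+h2+l" using h2 d by linarith+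
    show ?thesis unfolding sum_subtractf sum_shift_int e g_def ..
  qed
  have s2: "(\<Sum>m\<in>{c-h2..<c-h2+d}. G (m + d) - G m) = g (c-h1) (c+h+l) - g (c-h2) (c-h1)"
  proof -
    have e: "c-h2+d = c-h1" "c-h1+d = c+h+l" using h2 d by linarith+
    show ?thesis unfolding sum_subtractf sum_shift_int e g_def ..
  qed
  have gs: "(\<Sum>m\<in>{x..<y}. G m) = g x y" for x y by (simp add: g_def)
  show ?thesis unfolding s1 s2 gs c1 c2 c3 c4 by (simp add: algebra_simps)
qed

text \<open>Moving the window by one trades \<open>g c\<close> for the equal value
  \<open>g (c + q)\<close>; the induction runs from 1 in both directions.\<close>

lemma sum_over_period:
  fixes g :: "int \<Rightarrow> 'a::comm_monoid_add"
  assumes per: "\<And>m. g (m + int q) = g m"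
  shows "(\<Sum>m\<in>{c..<c+int q}. g m) = (\<Sum>m=1..int q. g m)"
proof -
  have step: "(\<Sum>m\<in>{c+1..<c+1+int q}. g m) = (\<Sum>m\<in>{c..<c+int q}. g m)" for c
  proof (cases "q = 0")
    case False
    have a: "{c..<c+int q} = insert c {c+1..<c+int q}"
      and b: "{c+1..<c+1+int q} = insert (c+int q) {c+1..<c+int q}" using False by auto
    show ?thesis unfolding a b using per[of c] by simp
  qed auto
  have "(\<Sum>m\<in>{c..<c+int q}. g m) = (\<Sum>m\<in>{1..<1+int q}. g m)"
  proof (induction c rule: int_induct[where k=1])
    case (step1 i) then show ?case using step[of i] by simp
  next
    case (step2 i) then show ?case using step[of "i-1"] by simp
  qed simp
  also have "{1..<1+int q} = {1..int q}" by auto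
  finally show ?thesis .
qed

section \<open>Periodicity and the mean square bound\<close>

locale periodic_mean_square =
  fixes f :: "int \<Rightarrow> complex" and q :: nat and A B :: real
  assumes B_pos: "B > 0"
    and q_pos: "q > 0"
    and bounded: "\<And>m. cmod (f m) \<le> A"
    and periodic: "\<And>m. f (m + int q) = f m"
    and mean_square: "\<And>K. (\<Sum>m=1..int q. (cmod (block_sum f m K))\<^sup>2) \<le> B * real q * real K"
begin

lemma block_sum_periodic: "block_sum f (m + int q) K = block_sum f m K"
proof -
  have "f (m + int q + k) = f (m + k)" for k
    using periodic[of "m + k"] by (simp add: algebra_simps)
  then show ?thesis by (simp add: block_sum_def)
qed

lemma block_sum_multiple: "block_sum f m (q * t) = of_nat t * block_sum f m q"
proof (induction t)
  case (Suc t)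
  have "block_sum f m (q * Suc t) = block_sum f m q + block_sum f m (q * t)"
    using block_sum_add[of f m q "q * t"] by (simp add: block_sum_periodic)
  then show ?case using Suc by (simp add: algebra_simps)
qed simp

lemma block_sum_period_eq: "block_sum f m q = (\<Sum>k=1..int q. f k)"
proof -
  have "block_sum f m q = (\<Sum>k\<in>{m+1..<m+1+int q}. f k)"
    unfolding block_sum_atLeastAtMost by (rule sum.cong) auto
  then show ?thesis by (simp add: sum_over_period[of f, OF periodic])
qed

text \<open>Over \<open>t\<close> periods the left side of the mean square bound grows like \<open>t\<^sup>2\<close>, the right side like \<open>t\<close>.\<close>

lemma block_sum_period_zero: "block_sum f m q = 0"
proof (rule ccontr)
  define z where "z = (\<Sum>k=1..int q. f k)"
  assume "block_sum f m q \<noteq> 0"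
  then have z: "(cmod z)\<^sup>2 > 0" by (simp add: block_sum_period_eq z_def)
  obtain t where t: "real t * (cmod z)\<^sup>2 > B * real q"
    using z reals_Archimedean3 by blast
  have tp: "t > 0" using t B_pos by (cases t) (auto simp: mult_less_0_iff)
  have "real q * (real t * cmod z)\<^sup>2 \<le> B * real q * real (q * t)"
    using mean_square[of "q * t"]
    by (simp add: block_sum_multiple block_sum_period_eq z_def norm_mult)
  then have "real q * real t * (real t * (cmod z)\<^sup>2) \<le> real q * real t * (B * real q)"
    by (simp add: power2_eq_square algebra_simps)
  then show False using t tp q_pos by simp
qed

text \<open>Cauchy-Schwarz against the constant 1. Since \<open>Z\<close> lies in a single period,
  its square sum is at most that of the whole period.\<close>

lemma sum_norm_block_sum_le:
  assumes "Z \<subseteq> {c..<c+int q}"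
  shows "(\<Sum>m\<in>Z. cmod (block_sum f m d)) \<le> sqrt (real (card Z) * (B * real q * real d))"
proof -
  have fin: "finite Z" using assms finite_subset by blast
  have "(\<Sum>m\<in>Z. (cmod (block_sum f m d))\<^sup>2) \<le> (\<Sum>m\<in>{c..<c+int q}. (cmod (block_sum f m d))\<^sup>2)"
    using assms by (intro sum_mono2) auto
  also have "\<dots> = (\<Sum>m=1..int q. (cmod (block_sum f m d))\<^sup>2)"
    by (rule sum_over_period) (simp add: block_sum_periodic)
  also have "\<dots> \<le> B * real q * real d" by (rule mean_square)
  finally have le: "(\<Sum>m\<in>Z. (cmod (block_sum f m d))\<^sup>2) \<le> B * real q * real d" .
  have "(\<Sum>m\<in>Z. 1 * cmod (block_sum f m d))\<^sup>2
      \<le> (\<Sum>m\<in>Z. 1\<^sup>2) * (\<Sum>m\<in>Z. (cmod (block_sum f m d))\<^sup>2)"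
    by (rule Cauchy_Schwarz_ineq_sum)
  also have "\<dots> \<le> real (card Z) * (B * real q * real d)"
    using le by (simp add: mult_left_mono)
  finally show ?thesis by (intro real_le_rsqrt) simp
qed

section \<open>Comparison of concentric windows\<close>

lemma shifted_windows_le:
  fixes x y :: int
  assumes xy: "x + int d \<le> y" and span: "y + int d \<le> x + int N" and N: "2 * N \<le> q"
  shows "cmod ((\<Sum>m\<in>{y..<y+int d}. block_sum f (m + int d) N - block_sum f m N)
             - (\<Sum>m\<in>{x..<x+int d}. block_sum f (m + int d) N - block_sum f m N))
         \<le> 2 * real d * sqrt (B * real q)"
proof -
  let ?n = "\<lambda>m. cmod (block_sum f m d)"
  let ?X = "{x..<x+int d}" let ?Y = "{y..<y+int d}"
  let ?X' = "{x+int N..<x+int d+int N}" let ?Y' = "{y+int N..<y+int d+int N}"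
  have one: "cmod (\<Sum>m\<in>{u..<u+int d}. block_sum f (m + int d) N - block_sum f m N)
     \<le> (\<Sum>m\<in>{u+int N..<u+int d+int N}. ?n m) + (\<Sum>m\<in>{u..<u+int d}. ?n m)" for u
  proof -
    have "cmod (\<Sum>m\<in>{u..<u+int d}. block_sum f (m + int d) N - block_sum f m N)
      \<le> (\<Sum>m\<in>{u..<u+int d}. ?n (m + int N) + ?n m)"
      unfolding block_sum_shift_diff by (intro sum_norm_le norm_triangle_ineq4)
    then show ?thesis
      by (simp add: sum.distrib sum_shift_int[where g="\<lambda>m. ?n m" and d="int N"])
  qed
  \<comment> \<open>The four windows are disjoint and end by \<open>x + 2 * N\<close>, hence fit in
    one period. A single Cauchy-Schwarz over all \<open>4 * d\<close> points gives the factor 2;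
    treating the windows separately would give 4.\<close>
  let ?Z = "(?X \<union> ?Y) \<union> (?X' \<union> ?Y')"
  have "cmod ((\<Sum>m\<in>?Y. block_sum f (m + int d) N - block_sum f m N)
             - (\<Sum>m\<in>?X. block_sum f (m + int d) N - block_sum f m N))
     \<le> ((\<Sum>m\<in>?Y'. ?n m) + (\<Sum>m\<in>?Y. ?n m)) + ((\<Sum>m\<in>?X'. ?n m) + (\<Sum>m\<in>?X. ?n m))"
    by (rule order_trans[OF norm_triangle_ineq4 add_mono[OF one one]])
  also have "\<dots> = (\<Sum>m\<in>?Z. ?n m)"
  proof -
    have "(?X \<union> ?Y) \<inter> (?X' \<union> ?Y') = {}" "?X \<inter> ?Y = {}" "?X' \<inter> ?Y' = {}"
      using xy span by auto
    then show ?thesis by (simp add: sum.union_disjoint)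
  qed
  also have "\<dots> \<le> sqrt (real (card ?Z) * (B * real q * real d))"
    by (rule sum_norm_block_sum_le[where c=x]) (use xy span N in auto)
  also have "\<dots> \<le> sqrt ((4 * real d) * (B * real q * real d))"
  proof -
    have "card ?Z \<le> (d + d) + (d + d)"
      by (intro order_trans[OF card_Un_le] add_mono) auto
    then have "real (card ?Z) \<le> 4 * real d" by linarith
    then show ?thesis using B_pos by (intro real_sqrt_le_mono mult_right_mono) auto
  qed
  also have "\<dots> = sqrt ((2 * real d)\<^sup>2 * (B * real q))"
    by (simp add: power2_eq_square algebra_simps)
  also have "\<dots> = 2 * real d * sqrt (B * real q)"
    unfolding real_sqrt_mult real_sqrt_abs by simp
  finally show ?thesis .
qed

text \<open>This explains the recurrence of \<open>p_shift\<close>: the defects obey the homogeneous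
  recurrence of \<open>q_shift\<close> up to an error \<open>2 * d * sqrt (B * q)\<close>, and
  \<open>d\<close> is \<open>L\<close> times half the sum of the two preceding terms of
  \<open>q_shift\<close>.\<close>

lemma window_defect:
  fixes c :: int and L N :: nat
  defines "W \<equiv> \<lambda>k. \<Sum>m\<in>{c - int (half_q k * L)..<c + int (half_q k * L) + int L}. block_sum f m N"
  assumes "q_shift k * int L \<le> int N" and N: "2 * N \<le> q"
  shows "cmod (W k - of_int (q_shift k) * W 0) \<le> 2 * p_shift k * real L * sqrt (B * real q)"
  using assms(2)
proof (induction k rule: half_q.induct)
  case (3 k)
  let ?G = "\<lambda>m. block_sum f m N"
  let ?h = "int (half_q k * L)" let ?h1 = "int (half_q (Suc k) * L)"
  let ?h2 = "int (half_q (Suc (Suc k)) * L)"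
  define d where "d = (half_q (Suc k) + half_q k + 1) * L"
  have h2: "?h2 = ?h1 + int d" and d: "int d = ?h1 + ?h + int L"
    unfolding d_def by (simp_all add: algebra_simps)
  have h1: "?h \<le> ?h1" using half_q_mono[of k] by (simp add: mult_right_mono)
  have pos: "0 \<le> ?h" "0 \<le> int L" by simp_all
  have q2: "2 * ?h2 + int L \<le> int N"
    using "3.prems" by (simp add: q_shift_eq_half_q algebra_simps)
  have le: "q_shift (Suc k) * int L \<le> int N" "q_shift k * int L \<le> int N"
    using q2 h1 h2 d pos by (simp_all add: q_shift_eq_half_q algebra_simps)
  let ?x = "c - ?h2" let ?y = "c - ?h"
  let ?E = "(\<Sum>m\<in>{?y..<?y+int d}. ?G (m + int d) - ?G m) - (\<Sum>m\<in>{?x..<?x+int d}. ?G (m + int d) - ?G m)"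
  \<comment> \<open>The side condition \<open>?x + d\<close> \<le> \<open>?y\<close> amounts to
    \<open>?h\<close> \<le> \<open>?h1\<close>, and \<open>?y + d\<close> \<le>
    \<open>?x + N\<close> to \<open>?h1 + ?h2 + L\<close> \<le> \<open>N\<close>, which follows from
    \<open>q2\<close>.\<close>
  have E: "cmod ?E \<le> 2 * real d * sqrt (B * real q)"
    by (rule shifted_windows_le) (use q2 h1 h2 d pos N in linarith)+
  have rec: "W (Suc (Suc k)) = 2 * W (Suc k) + W k + ?E"
    unfolding W_def by (rule window_sum_recursion[OF pos h1 h2 d])
  have "W (Suc (Suc k)) - of_int (q_shift (Suc (Suc k))) * W 0
     = 2 * (W (Suc k) - of_int (q_shift (Suc k)) * W 0) + (W k - of_int (q_shift k) * W 0) + ?E"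
    unfolding rec by (simp add: algebra_simps)
  also have "cmod \<dots> \<le> 2 * (2 * p_shift (Suc k) * real L * sqrt (B * real q))
      + 2 * p_shift k * real L * sqrt (B * real q) + 2 * real d * sqrt (B * real q)"
    by (intro norm_triangle_mono E "3.IH"(2) le)
      (unfold norm_mult norm_numeral, intro mult_left_mono "3.IH"(1)[OF le(1)] zero_le_numeral)
  also have "\<dots> = 2 * p_shift (Suc (Suc k)) * real L * sqrt (B * real q)"
  proof -
    have "real d = real_of_int (q_shift (Suc k) + q_shift k) / 2 * real L"
      unfolding d_def q_shift_eq_half_q by (simp add: algebra_simps)
    then show ?thesis by (simp add: algebra_simps add_divide_distrib)
  qed
  finally show ?case .
qed (simp_all add: W_def)

section \<open>Averages over windows\<close>

definition window_avg :: "nat \<Rightarrow> int \<Rightarrow> nat \<Rightarrow> complex" where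
  "window_avg N c L = (\<Sum>m\<in>{c..<c+int L}. block_sum f m N) / of_nat L"

text \<open>This is \<open>window_defect\<close> divided by \<open>Q * L\<close>. The new left end
  stays existential because the bound on the last average is uniform in its position.\<close>

lemma window_avg_step:
  assumes L: "L > 0" and QL: "Q * L \<le> N" and N: "2 * N \<le> q" and Q: "int Q = q_seq n"
  shows "\<exists>c'. cmod (window_avg N c' (Q * L) - window_avg N c L) \<le> 2 * p_seq n / real Q * sqrt (B * real q)"
proof -
  define h where "h = half_q (n + 2)"
  let ?c = "c - int (h * L)"
  have Qh: "int Q = 2 * int h + 1" using Q by (simp only: q_seq_def q_shift_eq_half_q h_def)
  have Qpos: "Q > 0" using Qh by linarith
  have "q_seq n * int L \<le> int N" unfolding Q[symmetric] using QL by (metis of_nat_le_iff of_nat_mult)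
  from window_defect[OF this[unfolded q_seq_def] N, where c=c, folded h_def q_seq_def p_seq_def]
  have "cmod ((\<Sum>m\<in>{?c..<c + int (h * L) + int L}. block_sum f m N)
      - of_int (q_seq n) * (\<Sum>m\<in>{c..<c + int L}. block_sum f m N)) \<le> 2 * p_seq n * real L * sqrt (B * real q)"
    by simp
  moreover have "c + int (h * L) + int L = ?c + int (Q * L)"
    using Qh by (simp add: algebra_simps)
  moreover have "of_int (q_seq n) = (of_nat Q :: complex)"
    using Q by (metis of_int_of_nat_eq)
  ultimately have D: "cmod ((\<Sum>m\<in>{?c..<?c + int (Q * L)}. block_sum f m N)
      - of_nat Q * (\<Sum>m\<in>{c..<c + int L}. block_sum f m N)) \<le> 2 * p_seq n * real L * sqrt (B * real q)"
    (is "cmod ?D \<le> _")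
    by (simp only:)
  have "window_avg N ?c (Q * L) - window_avg N c L = ?D / of_nat (Q * L)"
    unfolding window_avg_def using L Qpos by (simp add: field_simps)
  then have "cmod (window_avg N ?c (Q * L) - window_avg N c L) = cmod ?D / (real Q * real L)"
    by (simp add: norm_divide norm_mult)
  also have "\<dots> \<le> (2 * p_seq n * real L * sqrt (B * real q)) / (real Q * real L)"
    using D by (intro divide_right_mono) auto
  also have "\<dots> = 2 * p_seq n / real Q * sqrt (B * real q)" using L by simp
  finally show ?thesis by blast
qed

lemma window_avg_iterate:
  assumes L: "L > 0" and QL: "Q ^ k * L \<le> N" and N: "2 * N \<le> q" and Q: "int Q = q_seq n"
  shows "\<exists>c'. cmod (window_avg N c' (Q ^ k * L) - window_avg N c L)
    \<le> real k * (2 * p_seq n / real Q * sqrt (B * real q))"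
  using QL
proof (induction k)
  case 0
  show ?case by (rule exI[of _ c]) simp
next
  case (Suc k)
  have Qpos: "Q > 0" using Q q_seq_ge_3[of n] by linarith
  have "Q ^ k * L \<le> Q ^ Suc k * L" using Qpos by simp
  then obtain c1 where c1: "cmod (window_avg N c1 (Q ^ k * L) - window_avg N c L)
    \<le> real k * (2 * p_seq n / real Q * sqrt (B * real q))"
    using Suc by (meson le_trans)
  obtain c2 where c2: "cmod (window_avg N c2 (Q * (Q ^ k * L)) - window_avg N c1 (Q ^ k * L))
    \<le> 2 * p_seq n / real Q * sqrt (B * real q)"
    using window_avg_step[of "Q ^ k * L" Q N n c1] L Qpos Suc.prems N Q by (auto simp: mult.assoc)
  have "cmod (window_avg N c2 (Q * (Q ^ k * L)) - window_avg N c L)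
     \<le> 2 * p_seq n / real Q * sqrt (B * real q) + real k * (2 * p_seq n / real Q * sqrt (B * real q))"
    by (rule norm_diff_triangle_le[OF c2 c1])
  then show ?case
    by (intro exI[of _ c2]) (simp add: algebra_simps add_divide_distrib)
qed

lemma norm_window_avg_le:
  assumes "L > 0" "L \<le> q"
  shows "cmod (window_avg N c L) \<le> sqrt (B * real q * real N / real L)"
proof -
  have "cmod (\<Sum>m\<in>{c..<c+int L}. block_sum f m N) \<le> (\<Sum>m\<in>{c..<c+int L}. cmod (block_sum f m N))"
    by (rule norm_sum)
  also have "\<dots> \<le> sqrt (real (card {c..<c+int L}) * (B * real q * real N))"
    by (rule sum_norm_block_sum_le[where c=c]) (use assms in auto)
  also have "\<dots> = real L * sqrt (B * real q * real N / real L)"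
  proof -
    have "real L * sqrt (B * real q * real N / real L) = sqrt ((real L)\<^sup>2 * (B * real q * real N / real L))"
      by (subst real_sqrt_mult) simp
    then show ?thesis using assms by (simp add: power2_eq_square)
  qed
  finally have le: "cmod (\<Sum>m\<in>{c..<c+int L}. block_sum f m N) \<le> real L * sqrt (B * real q * real N / real L)" .
  have "cmod (window_avg N c L) = cmod (\<Sum>m\<in>{c..<c+int L}. block_sum f m N) / real L"
    by (simp add: window_avg_def norm_divide)
  also have "\<dots> \<le> (real L * sqrt (B * real q * real N / real L)) / real L"
    by (rule divide_right_mono[OF le]) simp
  finally show ?thesis using assms by simp
qed

section \<open>From an average to the value at its centre\<close>

lemma norm_block_sum_le: "cmod (block_sum f m K) \<le> A * real K"
  using sum_norm_bound[of "{1..int K}" "\<lambda>k. f (m + k)" A] bounded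
  by (simp add: block_sum_def mult.commute)

lemma block_sum_lipschitz: "cmod (block_sum f (a + j) N - block_sum f a N) \<le> 2 * A * real_of_int \<bar>j\<bar>"
proof -
  have nat: "cmod (block_sum f (b + int d) N - block_sum f b N) \<le> 2 * A * real d" for b d
    unfolding block_sum_shift_diff
    using norm_triangle_ineq4[of "block_sum f (b + int N) d" "block_sum f b d"]
      norm_block_sum_le[of "b + int N" d] norm_block_sum_le[of b d] by linarith
  show ?thesis
  proof (cases "j \<ge> 0")
    case True
    then show ?thesis using nat[of a "nat j"] by simp
  next
    case False
    then show ?thesis using nat[of "a + j" "nat (- j)"] by (simp add: norm_minus_commute)
  qed
qed

lemma sum_abs_window:
  "4 * (\<Sum>j\<in>{- int s..<int t}. \<bar>j\<bar>) = 2 * int s * (int s + 1) + 2 * int t * (int t - 1)"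
proof -
  have neg: "2 * (\<Sum>j\<in>{- int s..<0}. \<bar>j\<bar>) = int s * (int s + 1)"
  proof (induction s)
    case (Suc s)
    have "{- int (Suc s)..<0} = insert (- int s - 1) {- int s..<0}" by auto
    then show ?case using Suc by (simp add: algebra_simps)
  qed simp
  have pos: "2 * (\<Sum>j\<in>{0..<int t}. \<bar>j\<bar>) = int t * (int t - 1)"
  proof (induction t)
    case (Suc t)
    have "{0..<int (Suc t)} = insert (int t) {0..<int t}" by auto
    then show ?case using Suc by (simp add: algebra_simps)
  qed simp
  show ?thesis
    using neg pos by (simp add: sum_concat_int[of "- int s" 0 "int t"])
qed

text \<open>The Lipschitz bound \<open>2 * A * |j|\<close> is averaged over the centred window,
  where the mean of \<open>|j|\<close> is at most \<open>L / 4\<close>.\<close>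

lemma window_avg_near:
  assumes L: "L > 0"
  shows "cmod (window_avg N (a - int (L div 2)) L - block_sum f a N) \<le> A * real L / 2"
proof -
  define s where "s = L div 2"
  define t where "t = L - s"
  have st: "s + t = L" "t = s \<or> t = s + 1" unfolding s_def t_def by auto
  have A: "A \<ge> 0" using bounded[of 0] norm_ge_zero order_trans by blast
  let ?D = "\<Sum>j\<in>{- int s..<int t}. block_sum f (a + j) N - block_sum f a N"
  have "cmod ?D \<le> (\<Sum>j\<in>{- int s..<int t}. 2 * A * real_of_int \<bar>j\<bar>)"
    by (intro sum_norm_le block_sum_lipschitz)
  also have "\<dots> = 2 * A * real_of_int (\<Sum>j\<in>{- int s..<int t}. \<bar>j\<bar>)"
    by (simp add: sum_distrib_left)
  also have "\<dots> \<le> 2 * A * ((real L)\<^sup>2 / 4)"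
  proof -
    \<comment> \<open>The left side is \<open>L^2\<close> for even \<open>L\<close> and
      \<open>L^2 - 1\<close> for odd \<open>L\<close>.\<close>
    have "4 * (\<Sum>j\<in>{- int s..<int t}. \<bar>j\<bar>) \<le> int L * int L"
      unfolding sum_abs_window using st by (auto simp: algebra_simps)
    then have "real_of_int (4 * (\<Sum>j\<in>{- int s..<int t}. \<bar>j\<bar>)) \<le> real_of_int (int L * int L)"
      by (simp only: of_int_le_iff)
    then have "4 * real_of_int (\<Sum>j\<in>{- int s..<int t}. \<bar>j\<bar>) \<le> (real L)\<^sup>2"
      by (simp add: power2_eq_square)
    then show ?thesis using A by (intro mult_left_mono) auto
  qed
  finally have D: "cmod ?D \<le> real L * (A * real L / 2)" by (simp add: power2_eq_square ac_simps)
  have "- int s + a = a - int s" "int t + a = a - int s + int L" using st by auto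
  then have "(\<Sum>m\<in>{a - int s..<a - int s + int L}. block_sum f m N) = (\<Sum>j\<in>{- int s..<int t}. block_sum f (a + j) N)"
    using sum_shift_int[where g="\<lambda>m. block_sum f m N" and a="- int s" and b="int t" and d=a]
    by (simp only: add.commute[of a])
  then have "window_avg N (a - int s) L - block_sum f a N = ?D / of_nat L"
    unfolding window_avg_def using L st(1) by (simp add: sum_subtractf field_simps flip: of_nat_add)
  then have "cmod (window_avg N (a - int s) L - block_sum f a N) = cmod ?D / real L"
    by (simp add: norm_divide)
  also have "\<dots> \<le> real L * (A * real L / 2) / real L"
    by (rule divide_right_mono[OF D]) simp
  finally show ?thesis using L by (simp add: s_def)
qed

section \<open>The estimate for at most half a period\<close>

lemma block_sum_short_le:
  assumes N: "2 * N \<le> q" and Q: "int Q = q_seq n" and q: "q \<ge> 4"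
  shows "cmod (block_sum f a N) \<le> sqrt B * delta n * sqrt (real q) * ln (real q)
    + sqrt B * sqrt (real Q) * sqrt (real q) + 1 / 2 * A * sqrt (real q)"
proof -
  define M where "M = nat \<lfloor>sqrt (real q)\<rfloor>"
  have sq2: "sqrt (real q) \<ge> 2" using q by (intro real_le_rsqrt) simp
  have M: "real M \<le> sqrt (real q)" "sqrt (real q) < real M + 1" "M \<ge> 2"
    using sq2 unfolding M_def by (linarith)+
  have A: "A \<ge> 0" using bounded[of 0] norm_ge_zero order_trans by blast
  have Q3: "Q \<ge> 3" using Q q_seq_ge_3[of n] by linarith
  have lnQ: "ln (real Q) > 0" using Q3 by simp
  have lnq: "ln (real q) \<ge> 0" using q by simp
  have p: "p_seq n \<ge> 0" by (rule p_seq_nonneg)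
  have delta: "delta n = p_seq n / (real Q * ln (real Q))"
    unfolding delta_def using Q by (metis of_int_of_nat_eq)
  have main0: "0 \<le> sqrt B * delta n * sqrt (real q) * ln (real q)"
    using B_pos delta p lnQ lnq by simp
  show ?thesis
  proof (cases "N < M")
    case True
    \<comment> \<open>The window of length \<open>M\<close> is too long here. The window of length
      \<open>N\<close> itself serves: its average is at most \<open>sqrt (B * q)\<close>, and its
      distance from the centre value is at most \<open>A * N / 2\<close>.\<close>
    show ?thesis
    proof (cases "N = 0")
      case True
      then show ?thesis using main0 A B_pos by simp
    next
      case False
      then have "cmod (window_avg N (a - int (N div 2)) N) \<le> sqrt (B * real q)"
        using norm_window_avg_le[of N N "a - int (N div 2)"] N by simp
      moreover have "cmod (window_avg N (a - int (N div 2)) N - block_sum f a N) \<le> A * real N / 2"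
        using False by (intro window_avg_near) simp
      moreover have "A * real N \<le> A * sqrt (real q)"
        using True M A by (intro mult_left_mono) auto
      moreover have "sqrt (B * real q) \<le> sqrt B * sqrt (real Q) * sqrt (real q)"
        using Q3 B_pos q by (simp add: real_sqrt_mult)
      moreover have "cmod (block_sum f a N) \<le> cmod (window_avg N (a - int (N div 2)) N)
          + cmod (window_avg N (a - int (N div 2)) N - block_sum f a N)"
        using norm_triangle_ineq4[of "window_avg N (a - int (N div 2)) N" "window_avg N (a - int (N div 2)) N - block_sum f a N"]
        by simp
      ultimately show ?thesis using main0 by linarith
    qed
  next
    case False
    have ex: "\<exists>k. N \<le> Q ^ Suc k * M"
    proof
      have "N < Q ^ N" using Q3 by (intro power_gt_expt) simp
      also have "\<dots> \<le> Q ^ Suc N * M" using Q3 M by simp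
      finally show "N \<le> Q ^ Suc N * M" by simp
    qed
    \<comment> \<open>Minimality gives \<open>Q ^ k * M\<close> \<le> \<open>N\<close>, which
      permits \<open>k\<close> enlargements, while \<open>N\<close> \<le>
      \<open>Q ^ Suc k * M\<close> bounds the ratio of \<open>N\<close> to the final length by
      \<open>Q\<close>.\<close>
    define k where "k = (LEAST k. N \<le> Q ^ Suc k * M)"
    have k1: "N \<le> Q ^ Suc k * M" unfolding k_def by (rule LeastI_ex[OF ex])
    have k2: "Q ^ k * M \<le> N"
    proof (cases k)
      case 0
      then show ?thesis using False by simp
    next
      case (Suc j)
      then have "\<not> N \<le> Q ^ Suc j * M" using not_less_Least[of j "\<lambda>k. N \<le> Q ^ Suc k * M"] k_def by simp
      then show ?thesis using Suc by simp
    qed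
    let ?L = "Q ^ k * M"
    have Lpos: "?L > 0" using Q3 M by simp
    obtain c' where c': "cmod (window_avg N c' ?L - window_avg N (a - int (M div 2)) M)
        \<le> real k * (2 * p_seq n / real Q * sqrt (B * real q))"
      using window_avg_iterate[of M Q k N n "a - int (M div 2)"] k2 M N Q by auto
    have near: "cmod (window_avg N (a - int (M div 2)) M - block_sum f a N) \<le> A * real M / 2"
      using M by (intro window_avg_near) simp
    have "cmod (window_avg N c' ?L) \<le> sqrt (B * real q * real N / real ?L)"
      using Lpos k2 N by (intro norm_window_avg_le) auto
    also have "\<dots> \<le> sqrt (B * real q * real Q)"
    proof (rule real_sqrt_le_mono)
      have "real N \<le> real Q * real ?L"
        using k1 by (simp add: mult.assoc flip: of_nat_mult of_nat_power)
      then have "B * real q * real N \<le> B * real q * (real Q * real ?L)"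
        using B_pos by (intro mult_left_mono) auto
      then show "B * real q * real N / real ?L \<le> B * real q * real Q"
        using Lpos by (subst pos_divide_le_eq) (auto simp: mult.assoc)
    qed
    also have "\<dots> = sqrt B * sqrt (real Q) * sqrt (real q)"
      by (simp add: real_sqrt_mult)
    finally have last: "cmod (window_avg N c' ?L) \<le> sqrt B * sqrt (real Q) * sqrt (real q)" .
    \<comment> \<open>The factor 2 in \<open>2 * N\<close> \<le> \<open>q\<close> absorbs the loss
      from rounding \<open>sqrt q\<close> down to \<open>M\<close>, because \<open>sqrt q\<close>
      \<le> \<open>2 * M\<close>. Hence \<open>Q ^ k\<close> \<le> \<open>sqrt q\<close>
      exactly.\<close>
    have "real k * (2 * ln (real Q)) \<le> ln (real q)"
    proof -
      have "2 * real (Q ^ k) * real M \<le> real q"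
      proof -
        have "2 * (Q ^ k * M) \<le> q" using k2 N by linarith
        then have "real (2 * (Q ^ k * M)) \<le> real q" by (simp only: of_nat_le_iff)
        then show ?thesis by (simp add: mult.assoc)
      qed
      also have "real q = sqrt (real q) * sqrt (real q)" by simp
      also have "\<dots> \<le> sqrt (real q) * (2 * real M)"
        using M by (intro mult_left_mono) auto
      finally have "real (Q ^ k) * (2 * real M) \<le> sqrt (real q) * (2 * real M)"
        by (simp add: algebra_simps)
      then have "real Q ^ k \<le> sqrt (real q)" using M by simp
      then have "ln (real Q ^ k) \<le> ln (sqrt (real q))" using Q3 by (subst ln_le_cancel_iff) (use q in auto)
      then show ?thesis using Q3 q by (simp add: ln_realpow ln_sqrt)
    qed
    then have "real k * (2 * p_seq n / real Q * sqrt (B * real q)) \<le> delta n * ln (real q) * sqrt (B * real q)"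
    proof -
      assume le: "real k * (2 * ln (real Q)) \<le> ln (real q)"
      \<comment> \<open>By the definition of \<open>delta\<close>, \<open>p_seq n / Q\<close> is
        \<open>delta n * ln Q\<close>, so the number of steps enters only through
        \<open>k * 2 * ln Q\<close>.\<close>
      have "real k * (2 * p_seq n / real Q * sqrt (B * real q))
          = (real k * (2 * ln (real Q))) * (delta n * sqrt (B * real q))"
        using lnQ by (simp add: delta field_simps)
      also have "\<dots> \<le> ln (real q) * (delta n * sqrt (B * real q))"
        using le p lnQ B_pos by (intro mult_right_mono) (auto simp: delta)
      finally show ?thesis by (simp add: algebra_simps)
    qed
    then have mid: "real k * (2 * p_seq n / real Q * sqrt (B * real q)) \<le> sqrt B * delta n * sqrt (real q) * ln (real q)"
      by (simp add: real_sqrt_mult algebra_simps)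
    have AM: "A * real M \<le> A * sqrt (real q)" using M A by (intro mult_left_mono) auto
    have "cmod (window_avg N c' ?L - block_sum f a N)
        \<le> real k * (2 * p_seq n / real Q * sqrt (B * real q)) + A * real M / 2"
      by (rule norm_diff_triangle_le[OF c' near])
    moreover have "cmod (block_sum f a N) \<le> cmod (window_avg N c' ?L) + cmod (window_avg N c' ?L - block_sum f a N)"
      using norm_triangle_ineq4[of "window_avg N c' ?L" "window_avg N c' ?L - block_sum f a N"] by simp
    ultimately show ?thesis using last mid AM by linarith
  qed
qed

section \<open>Reduction to half a period, and the final bound\<close>

lemma norm_block_sum_half_period:
  "\<exists>b M. 2 * M \<le> q \<and> cmod (block_sum f a N) = cmod (block_sum f b M)"
proof -
  define r where "r = N mod q"
  have r: "r < q" using q_pos by (simp add: r_def)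
  have "block_sum f a N = block_sum f a (r + q * (N div q))"
    by (simp add: r_def add.commute)
  then have eq: "block_sum f a N = block_sum f a r"
    unfolding block_sum_add block_sum_multiple by (simp add: block_sum_period_zero)
  show ?thesis
  proof (cases "2 * r \<le> q")
    case True
    then show ?thesis using eq by metis
  next
    case False
    \<comment> \<open>The complementary \<open>q - r\<close> terms of the period have the opposite
      sum, and they number fewer than \<open>q / 2\<close>.\<close>
    have "block_sum f a r + block_sum f (a + int r) (q - r) = 0"
      using block_sum_add[of f a r "q - r"] r by (simp add: block_sum_period_zero)
    then have "cmod (block_sum f a N) = cmod (block_sum f (a + int r) (q - r))"
      using eq by (metis add_eq_0_iff norm_minus_cancel)
    moreover have "2 * (q - r) \<le> q" using False by simp
    ultimately show ?thesis by blast
  qed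
qed

end

theorem theorem1:
  fixes A B :: real and q :: nat and f :: "int \<Rightarrow> complex" and n :: nat
  assumes "A > 0" and "B > 0"
    and "\<And>m::int. cmod (f m) \<le> A"
    and "\<And>m::int. f (m + int q) = f m"
    and "\<And>K::nat. (\<Sum>m=1..int q. (cmod (\<Sum>k=1..int K. f (m + k)))\<^sup>2) \<le> B * real q * real K"
    and "int q \<ge> q_seq n ^ 6"
  shows "\<forall>(a::int) (N::nat). N > 0 \<longrightarrow>
    cmod (\<Sum>m=a+1..a+int N. f m)
      \<le> sqrt B * delta n * sqrt (real q) * ln (real q)
        + (sqrt B * sqrt (real_of_int (q_seq n) + 1 / (real_of_int (q_seq n))\<^sup>2)
           + sqrt B * (sqrt 2 - 1) * (2 * p_seq n / (real_of_int (q_seq n) - 1))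
           + 1 / 2 * A) * sqrt (real q)
        + psi n q B"
proof (intro allI impI)
  fix a :: int and N :: nat
  define Q where "Q = nat (q_seq n)"
  have Q3: "Q \<ge> 3" and Q: "int Q = q_seq n" using q_seq_ge_3[of n] by (simp_all add: Q_def)
  have Qr: "real_of_int (q_seq n) = real Q" using Q by (metis of_int_of_nat_eq)
  have "(3::int) ^ 6 \<le> q_seq n ^ 6" using q_seq_ge_3[of n] by (intro power_mono) auto
  then have q4: "q \<ge> 4" using assms(6) by simp
  interpret periodic_mean_square f q A B
    by unfold_locales (use assms q4 in \<open>auto simp: block_sum_def\<close>)
  obtain b M where M: "2 * M \<le> q" "cmod (block_sum f a N) = cmod (block_sum f b M)"
    using norm_block_sum_half_period by blast
  have p: "p_seq n \<ge> 0" by (rule p_seq_nonneg)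
  have s2: "sqrt 2 - 1 \<ge> (0::real)" by simp
  have r: "0 \<le> 2 * p_seq n / (real Q - 1)" using p Q3 by simp
  have "delta n \<ge> 0" "ln (real q) \<ge> 0"
    unfolding delta_def Qr using p Q3 q4 by simp_all
  \<comment> \<open>To pass from the bound of \<open>block_sum_short_le\<close> to the stated one,
    \<open>psi\<close> and \<open>e1\<close> supply nonnegative summands and \<open>e2\<close>
    enlarges the argument of the square root.\<close>
  then have psi: "psi n q B \<ge> 0"
    unfolding psi_def Qr using B_pos r s2 Q3
    by (intro mult_nonneg_nonneg add_nonneg_nonneg) auto
  have e1: "0 \<le> sqrt B * (sqrt 2 - 1) * (2 * p_seq n / (real Q - 1)) * sqrt (real q)"
    using B_pos r s2 by (intro mult_nonneg_nonneg) auto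
  have e2: "sqrt B * sqrt (real Q) * sqrt (real q) \<le> sqrt B * sqrt (real Q + 1 / (real Q)\<^sup>2) * sqrt (real q)"
    using B_pos by (intro mult_right_mono mult_left_mono) auto
  have "cmod (\<Sum>m=a+1..a+int N. f m) = cmod (block_sum f b M)"
    using M(2) by (simp add: block_sum_atLeastAtMost)
  also have "\<dots> \<le> sqrt B * delta n * sqrt (real q) * ln (real q)
    + sqrt B * sqrt (real Q) * sqrt (real q) + 1 / 2 * A * sqrt (real q)"
    by (rule block_sum_short_le[OF M(1) Q q4])
  finally show "cmod (\<Sum>m=a+1..a+int N. f m)
      \<le> sqrt B * delta n * sqrt (real q) * ln (real q)
        + (sqrt B * sqrt (real_of_int (q_seq n) + 1 / (real_of_int (q_seq n))\<^sup>2)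
           + sqrt B * (sqrt 2 - 1) * (2 * p_seq n / (real_of_int (q_seq n) - 1))
           + 1 / 2 * A) * sqrt (real q)
        + psi n q B"
    unfolding Qr distrib_right using psi e1 e2 by linarith
qed

end
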